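(* Let $\mathcal{K}$ be a conditionally complete idempotent semifield and $n\ge 1$. Let $C$ be a convex subset of $\mathcal{K}^n$ that is closed for the order topology of $\mathcal{K}^n$, and let $y\in\mathcal{K}^n\setminus C$. Then there exists an affine hyperplane of $\mathcal{K}^n$ containing $C$ and not $y$, i.e., there exist $w',w''\in\mathcal{K}^n$ and $d',d''\in\mathcal{K}$ such that $\langle w',x\rangle\oplus d'=\langle w'',x\rangle\oplus d''$ for all $x\in C$, whereas $\langle w',y\rangle\oplus d'\neq\langle w'',y\rangle\oplus d''$.
   Context: An idempotent semiring is a semiring $(\mathcal{S},\oplus,\otimes)$ with zero $\mathbf{0}$ (neutral for $\oplus$, absorbing for multiplication) and unit $\mathbf{1}$ such that $a\oplus a=a$; write $ab$ for $a\otimes b$. Its natural order is $a\le b\iff a\oplus b=b$, so $a\oplus b=a\vee b$ and $\mathbf{0}$ is the bottom element. An idempotent semifield is an idempotent semiring whose nonzero elements are invertible for multiplication. An ordered set is conditionally complete if every nonempty subset bounded above has a least upper bound and every nonempty subset bounded below has a greatest lower bound. An idempotent semifield $\mathcal{K}$ is conditionally complete if it is so for its natural order and left and right multiplications by any element preserve sups of nonempty sets bounded above. $\mathcal{K}^n$ has the entrywise addition and order, and the entrywise right action $(x,\lambda)\mapsto x\lambda$. For $w,x\in\mathcal{K}^n$, $\langle w,x\rangle=\bigoplus_{1\le i\le n}w_ix_i$. $C\subset\mathcal{K}^n$ is convex if $x\alpha\oplus y\beta\in C$ for all $x,y\in C$ and $\alpha,\beta\in\mathcal{K}$ with $\alpha\oplus\beta=\mathbf{1}$.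 Order topology: a net $(x_\ell)_{\ell\in L}$ in a conditionally complete ordered set $S$, bounded from above and below, order converges to $x\in S$ if $x=\inf_{\ell}\sup_{m\ge\ell}x_m=\sup_{\ell}\inf_{m\ge\ell}x_m$. A subset $X\subset S$ is closed for the (Birkhoff) order topology if the limit of every order converging net with values in $X$ belongs to $X$. An affine hyperplane of $\mathcal{K}^n$ is a set of the form $\{x\in\mathcal{K}^n\mid\langle w',x\rangle\oplus d'=\langle w'',x\rangle\oplus d''\}$ with $w',w''\in\mathcal{K}^n$, $d',d''\in\mathcal{K}$. *)

theory Defs
  imports "HOL-Analysis.Finite_Cartesian_Product" "HOL-Library.Lub_Glb"
begin

class idempotent_semiring = semiring_0 + monoid_mult + order +
  assumes add_idem: "a + a = a"
    and le_iff_add_eq: "a \<le> b \<longleftrightarrow> a + b = b"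

text \<open>
  As for fields, zero and unit are required to be distinct. (Over the one-element semiring the
  only affine hyperplane is the whole space, so the empty convex set could not be separated from
  the unique point.) Multiplication is not assumed to be commutative.
\<close>

class idempotent_semifield = idempotent_semiring + zero_neq_one +
  assumes nonzero_invertible: "a \<noteq> 0 \<Longrightarrow> \<exists>b. a * b = 1 \<and> b * a = 1"

text \<open>
  The lattice structure is no extra assumption: binary suprema are sums, and binary infima
  exist by conditional completeness because \<open>0\<close> is a lower bound of every set.
\<close>

class cond_complete_idempotent_semifield = idempotent_semifield + conditionally_complete_lattice +
  assumes mult_cSup_left: "X \<noteq> {} \<Longrightarrow> bdd_above X \<Longrightarrow> a * Sup X = Sup ((\<lambda>x. a * x) ` X)"
    and mult_cSup_right: "X \<noteq> {} \<Longrightarrow> bdd_above X \<Longrightarrow> Sup X * a = Sup ((\<lambda>x. x * a) ` X)"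

definition right_scale :: "'a::times ^ 'n \<Rightarrow> 'a \<Rightarrow> 'a ^ 'n"  (infixl \<open>\<cdot>\<^sub>R\<close> 70)
  where "x \<cdot>\<^sub>R c = (\<chi> i. x $ i * c)"

definition pairing :: "'a::semiring_0 ^ 'n \<Rightarrow> 'a ^ 'n \<Rightarrow> 'a"
  where "pairing w x = (\<Sum>i\<in>UNIV. w $ i * x $ i)"

definition semimodule_convex :: "('a::idempotent_semiring ^ 'n) set \<Rightarrow> bool"
  where "semimodule_convex C \<longleftrightarrow>
    (\<forall>x\<in>C. \<forall>y\<in>C. \<forall>a b. a + b = 1 \<longrightarrow> x \<cdot>\<^sub>R a + y \<cdot>\<^sub>R b \<in> C)"

definition affine_hyperplane ::
    "'a::semiring_0 ^ 'n \<Rightarrow> 'a \<Rightarrow> 'a ^ 'n \<Rightarrow> 'a \<Rightarrow> ('a ^ 'n) set"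
  where "affine_hyperplane w' d' w'' d'' = {x. pairing w' x + d' = pairing w'' x + d''}"

definition directed_preorder :: "'i set \<Rightarrow> ('i \<Rightarrow> 'i \<Rightarrow> bool) \<Rightarrow> bool"
  where "directed_preorder L le \<longleftrightarrow> L \<noteq> {} \<and> reflp_on L le \<and> transp_on L le \<and>
    (\<forall>l\<in>L. \<forall>m\<in>L. \<exists>k\<in>L. le l k \<and> le m k)"

text \<open>
  Order convergence \<open>x = inf\<^sub>l sup\<^sub>m\<^sub>\<ge>\<^sub>l u\<^sub>m = sup\<^sub>l inf\<^sub>m\<^sub>\<ge>\<^sub>l u\<^sub>m\<close> of a bounded net, expressed with
  least upper and greatest lower bounds as relations. In a conditionally complete order the
  inner bounds exist, since the net is bounded.
\<close>

definition order_converges ::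
    "'i set \<Rightarrow> ('i \<Rightarrow> 'i \<Rightarrow> bool) \<Rightarrow> ('i \<Rightarrow> 'a::order) \<Rightarrow> 'a \<Rightarrow> bool"
  where "order_converges L le u x \<longleftrightarrow>
    directed_preorder L le \<and> bdd_above (u ` L) \<and> bdd_below (u ` L) \<and>
    isGlb UNIV {s. \<exists>l\<in>L. isLub UNIV (u ` {m \<in> L. le l m}) s} x \<and>
    isLub UNIV {s. \<exists>l\<in>L. isGlb UNIV (u ` {m \<in> L. le l m}) s} x"

text \<open>
  A definition cannot quantify over all index types. Nets indexed by subsets of
  \<^typ>\<open>'a set \<times> 'a\<close> suffice: by lemma \<open>order_closed_net\<close> below, a set closed in this sense
  contains the limits of its order convergent nets over every index type.
\<close>

definition order_closed :: "'a::order set \<Rightarrow> bool"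
  where "order_closed X \<longleftrightarrow>
    (\<forall>(L :: ('a set \<times> 'a) set) le u x. u ` L \<subseteq> X \<and> order_converges L le u x \<longrightarrow> x \<in> X)"

lemma order_closed_net:
  fixes L :: "'i set" and u :: "'i \<Rightarrow> 'a::order"
  assumes X: "order_closed X" and uX: "u ` L \<subseteq> X" and conv: "order_converges L le u x"
  shows "x \<in> X"
proof -
  define tail where "tail l = u ` {m \<in> L. le l m}" for l
  define N where "N = {(B, b). B \<in> tail ` L \<and> b \<in> B}"
  define ge :: "'a set \<times> 'a \<Rightarrow> 'a set \<times> 'a \<Rightarrow> bool"
    where "ge p q \<longleftrightarrow> fst q \<subseteq> fst p" for p q
  have dp: "directed_preorder L le"
    using conv unfolding order_converges_def by blast
  have nonempty: "L \<noteq> {}"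
    using dp unfolding directed_preorder_def by blast
  have refl: "le l l" if "l \<in> L" for l
    using dp that unfolding directed_preorder_def by (blast dest: reflp_onD)
  have trans: "le k m" if "k \<in> L" "l \<in> L" "m \<in> L" "le k l" "le l m" for k l m
    using dp that transp_onD unfolding directed_preorder_def by metis
  have directed: "\<exists>k\<in>L. le l k \<and> le m k" if "l \<in> L" "m \<in> L" for l m
    using dp that unfolding directed_preorder_def by blast
  have tail_mono: "tail m \<subseteq> tail l" if "l \<in> L" "m \<in> L" "le l m" for l m
    using that trans unfolding tail_def by blast
  have tail_in: "u l \<in> tail l" if "l \<in> L" for l
    using that refl unfolding tail_def by blast
  have snd_N: "snd ` N = u ` L"
  proof
    show "snd ` N \<subseteq> u ` L" unfolding N_def tail_def by auto
    show "u ` L \<subseteq> snd ` N"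
    proof
      fix a assume "a \<in> u ` L"
      then obtain l where "l \<in> L" "a = u l" by blast
      then have "(tail l, a) \<in> N" unfolding N_def using tail_in by simp
      then show "a \<in> snd ` N" by (rule rev_image_eqI) simp
    qed
  qed
  have N_tail: "snd ` {q \<in> N. ge p q} = fst p" if "p \<in> N" for p
  proof
    show "snd ` {q \<in> N. ge p q} \<subseteq> fst p" unfolding N_def ge_def by auto
    show "fst p \<subseteq> snd ` {q \<in> N. ge p q}"
    proof
      fix a assume "a \<in> fst p"
      then have "(fst p, a) \<in> {q \<in> N. ge p q}" using that unfolding N_def ge_def by auto
      then show "a \<in> snd ` {q \<in> N. ge p q}" by (rule rev_image_eqI) simp
    qed
  qed
  have fst_N: "fst ` N = tail ` L"
  proof
    show "fst ` N \<subseteq> tail ` L" unfolding N_def by auto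
    show "tail ` L \<subseteq> fst ` N"
    proof
      fix B assume "B \<in> tail ` L"
      then obtain l where "l \<in> L" "B = tail l" by blast
      then have "(B, u l) \<in> N" unfolding N_def using tail_in by simp
      then show "B \<in> fst ` N" by (rule rev_image_eqI) simp
    qed
  qed
  have "directed_preorder N ge"
    unfolding directed_preorder_def
  proof (intro conjI ballI)
    show "N \<noteq> {}" using fst_N nonempty by auto
    show "reflp_on N ge" "transp_on N ge"
      unfolding ge_def by (auto intro!: reflp_onI transp_onI)
    fix p q assume pq: "p \<in> N" "q \<in> N"
    then obtain l m where lm: "l \<in> L" "m \<in> L" "fst p = tail l" "fst q = tail m"
      unfolding N_def by auto
    obtain k where k: "k \<in> L" "le l k" "le m k" using directed lm by blast
    have "(tail k, u k) \<in> N" using k tail_in unfolding N_def by auto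
    moreover have "ge p (tail k, u k)" "ge q (tail k, u k)"
      using lm k tail_mono unfolding ge_def by auto
    ultimately show "\<exists>r\<in>N. ge p r \<and> ge q r" by blast
  qed
  moreover have "{s. \<exists>p\<in>N. P (snd ` {q \<in> N. ge p q}) s} = {s. \<exists>l\<in>L. P (u ` {m \<in> L. le l m}) s}"
    for P :: "'a set \<Rightarrow> 'a \<Rightarrow> bool"
  proof -
    have "(\<exists>p\<in>N. P (snd ` {q \<in> N. ge p q}) s) \<longleftrightarrow> (\<exists>B\<in>fst ` N. P B s)" for s
      using N_tail by auto
    then show ?thesis unfolding fst_N by (simp add: tail_def)
  qed
  ultimately have "order_converges N ge snd x"
    using conv unfolding order_converges_def snd_N by simp
  moreover have "snd ` N \<subseteq> X" using uX snd_N by simp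
  ultimately show ?thesis using X unfolding order_closed_def by blast
qed

end

theory Submission
  imports Defs
begin

text \<open>
  For \<open>z \<ge> y\<close> with nonzero entries, let \<open>\<mu>(x) = 1 \<oplus> \<langle>z\<^sup>-\<^sup>1, x\<rangle>\<close>; then \<open>x\<mu>(x)\<^sup>-\<^sup>1 \<le> z\<close> and
  \<open>\<mu>(x)\<^sup>-\<^sup>1 \<le> 1\<close>. Let \<open>q\<close> and \<open>\<nu>\<close> be the suprema of \<open>x\<mu>(x)\<^sup>-\<^sup>1\<close> and of \<open>\<mu>(x)\<^sup>-\<^sup>1\<close> over \<open>x \<in> C\<close>.
  On \<open>C\<close> one has \<open>x\<^sub>i \<le> q\<^sub>i \<mu>(x)\<close> and \<open>1 \<le> \<nu> \<mu>(x)\<close>, while \<open>\<mu>(y) = 1\<close>, so one of these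
  inequalities separates \<open>y\<close> from \<open>C\<close> unless \<open>y \<le> q\<close> and \<open>\<nu> = 1\<close>. In the latter case \<open>q\<close> is an
  order limit of convex combinations, hence \<open>q \<in> C\<close>, and \<open>y \<le> q \<le> z\<close>. If this happens for all
  \<open>z\<close>, then letting \<open>z\<close> decrease to \<open>y\<close> gives \<open>y \<in> C\<close>, a contradiction. Such \<open>z\<close> exist arbitrarily
  close to \<open>y\<close> unless the semifield is Boolean, a case that is settled by a finite argument.
\<close>

section \<open>Idempotent semifields\<close>

lemma add_ge1: "a \<le> a + b" for a b :: "'a::idempotent_semiring"
  by (simp add: le_iff_add_eq add_idem flip: add.assoc)

lemma add_ge2: "b \<le> a + b" for a b :: "'a::idempotent_semiring"
  using add_ge1[of b a] by (simp add: add.commute)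

lemma add_least: "a \<le> c \<Longrightarrow> b \<le> c \<Longrightarrow> a + b \<le> c" for a b c :: "'a::idempotent_semiring"
  by (simp add: le_iff_add_eq add.assoc)

lemma zero_least: "0 \<le> a" for a :: "'a::idempotent_semiring"
  by (simp add: le_iff_add_eq)

lemma le_zero_eq: "a \<le> 0 \<longleftrightarrow> a = 0" for a :: "'a::idempotent_semiring"
  by (simp add: le_iff_add_eq)

lemma mult_left_le: "a \<le> b \<Longrightarrow> c * a \<le> c * b" for a b c :: "'a::idempotent_semiring"
  by (simp add: le_iff_add_eq flip: distrib_left)

lemma mult_right_le: "a \<le> b \<Longrightarrow> a * c \<le> b * c" for a b c :: "'a::idempotent_semiring"
  by (simp add: le_iff_add_eq flip: distrib_right)

lemma sum_ge_member:
  fixes f :: "'i \<Rightarrow> 'a::idempotent_semiring"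
  assumes "finite A" "i \<in> A"
  shows "f i \<le> sum f A"
  using assms by (simp add: sum.remove add_ge1)

lemma sum_least:
  fixes f :: "'i \<Rightarrow> 'a::idempotent_semiring"
  assumes "\<And>i. i \<in> A \<Longrightarrow> f i \<le> c"
  shows "sum f A \<le> c"
  using assms by (induction A rule: infinite_finite_induct) (auto simp: zero_least add_least)

section \<open>Inverses and the order of a semifield\<close>

definition sf_inverse :: "'a::idempotent_semifield \<Rightarrow> 'a"
  where "sf_inverse a = (SOME b. a * b = 1 \<and> b * a = 1)"

lemma
  fixes a :: "'a::idempotent_semifield"
  assumes "a \<noteq> 0"
  shows sf_right_inverse: "a * sf_inverse a = 1" and sf_left_inverse: "sf_inverse a * a = 1"
  using someI_ex[OF nonzero_invertible[OF assms]] by (simp_all add: sf_inverse_def)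

lemma sf_inverse_nonzero: "a \<noteq> 0 \<Longrightarrow> sf_inverse a \<noteq> 0" for a :: "'a::idempotent_semifield"
  using sf_right_inverse[of a] by auto

lemma sf_inverse_one: "sf_inverse 1 = (1::'a::idempotent_semifield)"
  using sf_right_inverse[of "1::'a"] by simp

text \<open>Right multiplication by a nonzero element is an order automorphism, undone by its
  inverse. Left multiplication is treated apart because multiplication need not commute.\<close>

lemma le_mult_inverse_right_iff:
  fixes a b c :: "'a::idempotent_semifield"
  assumes "c \<noteq> 0"
  shows "a \<le> b * sf_inverse c \<longleftrightarrow> a * c \<le> b"
  using mult_right_le[of a "b * sf_inverse c" c] mult_right_le[of "a * c" b "sf_inverse c"] assms
  by (auto simp: mult.assoc sf_right_inverse sf_left_inverse)

lemma mult_inverse_right_le_iff: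
  fixes a b c :: "'a::idempotent_semifield"
  assumes "c \<noteq> 0"
  shows "a * sf_inverse c \<le> b \<longleftrightarrow> a \<le> b * c"
  using mult_right_le[of "a * sf_inverse c" b c] mult_right_le[of a "b * c" "sf_inverse c"] assms
  by (auto simp: mult.assoc sf_right_inverse sf_left_inverse)

lemma mult_inverse_left_le_iff:
  fixes a b c :: "'a::idempotent_semifield"
  assumes "c \<noteq> 0"
  shows "sf_inverse c * a \<le> b \<longleftrightarrow> a \<le> c * b"
  using mult_left_le[of "sf_inverse c * a" b c] mult_left_le[of a "c * b" "sf_inverse c"] assms
  by (auto simp: sf_right_inverse sf_left_inverse simp flip: mult.assoc)

lemma ge_one_nonzero: "1 \<le> a \<Longrightarrow> a \<noteq> 0" for a :: "'a::idempotent_semifield"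
  by (auto simp: le_zero_eq)

lemma le_nonzero: "a \<le> b \<Longrightarrow> a \<noteq> 0 \<Longrightarrow> b \<noteq> 0" for a :: "'a::idempotent_semifield"
  by (auto simp: le_zero_eq)

text \<open>The inverse of \<open>sf_inverse a + sf_inverse b\<close> is a nonzero common lower
  bound. Thus the nonzero elements are directed downwards.\<close>

lemma inf_nonzero:
  fixes a b :: "'a::cond_complete_idempotent_semifield"
  assumes "a \<noteq> 0" "b \<noteq> 0"
  shows "inf a b \<noteq> 0"
proof -
  define s where "s = sf_inverse a + sf_inverse b"
  have s: "s \<noteq> 0"
    using le_nonzero[OF add_ge1] sf_inverse_nonzero[OF assms(1)] by (simp add: s_def)
  have le: "1 * sf_inverse s \<le> c" if "c \<noteq> 0" "sf_inverse c \<le> s" for c :: 'a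
    using mult_left_le[OF that(2), of c]
    by (simp only: mult_inverse_right_le_iff[OF s] sf_right_inverse[OF that(1)])
  have "1 * sf_inverse s \<le> inf a b"
    using le[of a] le[of b] assms by (simp add: s_def add_ge1 add_ge2)
  then show ?thesis
    by (rule le_nonzero) (simp add: sf_inverse_nonzero[OF s])
qed

text \<open>If \<open>t\<close> were nonzero, so would be \<open>t * c\<close>, and cancelling
  \<open>t\<close> in \<open>t \<le> t * c\<close> would give \<open>1 \<le> c\<close>. So the
  nonzero elements have infimum 0, which fails in the Boolean semifield.\<close>

lemma le_all_nonzero_imp_zero:
  fixes t c :: "'a::idempotent_semifield"
  assumes c: "c \<noteq> 0" "\<not> 1 \<le> c" and t: "\<And>d. d \<noteq> 0 \<Longrightarrow> t \<le> d"
  shows "t = 0"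
proof (rule ccontr)
  assume t0: "t \<noteq> 0"
  have "t * c \<noteq> 0"
  proof
    assume "t * c = 0"
    then have "sf_inverse t * (t * c) = 0" by simp
    then show False using t0 c by (simp add: sf_left_inverse flip: mult.assoc)
  qed
  then have "sf_inverse t * t \<le> c"
    using t t0 by (simp add: mult_inverse_left_le_iff)
  then show False using c t0 by (simp add: sf_left_inverse)
qed

section \<open>Order limits of squeezed nets\<close>

lemma isLub_vec:
  fixes S :: "('a::conditionally_complete_lattice ^ 'n) set"
  assumes "S \<noteq> {}" "bdd_above S"
  shows "isLub UNIV S (\<chi> i. Sup ((\<lambda>x. x $ i) ` S))"
proof -
  obtain M where M: "\<And>x. x \<in> S \<Longrightarrow> x \<le> M" using assms(2) by (auto simp: bdd_above_def)
  have "bdd_above ((\<lambda>x. x $ i) ` S)" for i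
    using M by (intro bdd_aboveI[of _ "M $ i"]) (auto simp: less_eq_vec_def)
  then show ?thesis
    using assms(1)
    by (auto simp: isLub_def leastP_def setle_def setge_def isUb_def less_eq_vec_def
        intro!: cSUP_upper cSUP_least)
qed

lemma isGlb_vec:
  fixes S :: "('a::conditionally_complete_lattice ^ 'n) set"
  assumes "S \<noteq> {}" "bdd_below S"
  shows "isGlb UNIV S (\<chi> i. Inf ((\<lambda>x. x $ i) ` S))"
proof -
  obtain M where M: "\<And>x. x \<in> S \<Longrightarrow> M \<le> x" using assms(2) by (auto simp: bdd_below_def)
  have "bdd_below ((\<lambda>x. x $ i) ` S)" for i
    using M by (intro bdd_belowI[of _ "M $ i"]) (auto simp: less_eq_vec_def)
  then show ?thesis
    using assms(1)
    by (auto simp: isGlb_def greatestP_def setle_def setge_def isLb_def less_eq_vec_def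
        intro!: cINF_lower cINF_greatest)
qed

text \<open>The least index \<open>first\<close> makes the whole net bounded, as order convergence requires.\<close>

lemma order_closed_squeeze:
  fixes X :: "('a::conditionally_complete_lattice ^ 'n) set" and L :: "'i set"
  assumes X: "order_closed X" and uX: "\<And>l. l \<in> L \<Longrightarrow> u l \<in> X"
    and dir: "directed_preorder L le" and first: "first \<in> L" "\<And>l. l \<in> L \<Longrightarrow> le first l"
    and a: "\<And>l m. l \<in> L \<Longrightarrow> m \<in> L \<Longrightarrow> le l m \<Longrightarrow> a l \<le> a m"
    and b: "\<And>l m. l \<in> L \<Longrightarrow> m \<in> L \<Longrightarrow> le l m \<Longrightarrow> b m \<le> b l"
    and au: "\<And>l. l \<in> L \<Longrightarrow> a l \<le> u l" and ub: "\<And>l. l \<in> L \<Longrightarrow> u l \<le> b l"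
    and lub: "\<And>l. l \<in> L \<Longrightarrow> a l \<le> x" "\<And>t. (\<And>l. l \<in> L \<Longrightarrow> a l \<le> t) \<Longrightarrow> x \<le> t"
    and glb: "\<And>l. l \<in> L \<Longrightarrow> x \<le> b l" "\<And>t. (\<And>l. l \<in> L \<Longrightarrow> t \<le> b l) \<Longrightarrow> t \<le> x"
  shows "x \<in> X"
proof (rule order_closed_net[OF X])
  show "u ` L \<subseteq> X" using uX by auto
  define T where "T l = u ` {m \<in> L. le l m}" for l
  have refl: "le l l" if "l \<in> L" for l
    using dir that unfolding directed_preorder_def by (blast dest: reflp_onD)
  have directed: "\<exists>k\<in>L. le l k \<and> le m k" if "l \<in> L" "m \<in> L" for l m
    using dir that unfolding directed_preorder_def by blast
  have T_ne: "T l \<noteq> {}" if "l \<in> L" for l using refl that by (auto simp: T_def)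
  have T_le: "v \<le> b l" if "l \<in> L" "v \<in> T l" for l v
    using that b ub by (auto simp: T_def intro: order_trans)
  have T_ge: "a l \<le> v" if "l \<in> L" "v \<in> T l" for l v
    using that a au by (auto simp: T_def intro: order_trans)
  have lubT: "\<exists>s. isLub UNIV (T l) s" if "l \<in> L" for l
    using isLub_vec[OF T_ne bdd_aboveI] T_le that by blast
  have glbT: "\<exists>s. isGlb UNIV (T l) s" if "l \<in> L" for l
    using isGlb_vec[OF T_ne bdd_belowI] T_ge that by blast
  \<comment> \<open>Directedness gives an index \<open>m\<close> after both \<open>l\<close> and
    \<open>k\<close>, so the supremum of the tail at \<open>l\<close> lies above \<open>a k\<close>
    through \<open>u m\<close>.\<close>
  have "x \<le> s" if l: "l \<in> L" and s: "isLub UNIV (T l) s" for l s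
  proof (rule lub(2))
    fix k assume k: "k \<in> L"
    then obtain m where m: "m \<in> L" "le l m" "le k m" using directed l by blast
    have "a k \<le> u m" using a[OF k m(1,3)] au[OF m(1)] by (rule order_trans)
    also have "u m \<le> s"
      using isLubD2[OF s] m by (auto simp: T_def)
    finally show "a k \<le> s" .
  qed
  \<comment> \<open>The supremum of the tail at \<open>l\<close> is at most \<open>b l\<close>, so a
    lower bound of all these suprema is below every \<open>b l\<close>.\<close>
  moreover have "t \<le> x" if t: "\<And>l s. l \<in> L \<Longrightarrow> isLub UNIV (T l) s \<Longrightarrow> t \<le> s" for t
  proof (rule glb(2))
    fix l assume l: "l \<in> L"
    then obtain s where s: "isLub UNIV (T l) s" using lubT by blast
    have "s \<le> b l"
      using isLub_le_isUb[OF s] T_le[OF l] by (simp add: isUb_def setle_def)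
    then show "t \<le> b l" using t[OF l s] by (rule order_trans[rotated])
  qed
  ultimately have G: "isGlb UNIV {s. \<exists>l\<in>L. isLub UNIV (T l) s} x"
    unfolding isGlb_def greatestP_def setle_def setge_def isLb_def by blast
  have "s \<le> x" if l: "l \<in> L" and s: "isGlb UNIV (T l) s" for l s
  proof (rule glb(2))
    fix k assume k: "k \<in> L"
    then obtain m where m: "m \<in> L" "le l m" "le k m" using directed l by blast
    have "s \<le> u m"
      using isGlbD2[OF s] m by (auto simp: T_def)
    also have "u m \<le> b k" using ub[OF m(1)] b[OF k m(1,3)] by (rule order_trans)
    finally show "s \<le> b k" .
  qed
  moreover have "x \<le> t" if t: "\<And>l s. l \<in> L \<Longrightarrow> isGlb UNIV (T l) s \<Longrightarrow> s \<le> t" for t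
  proof (rule lub(2))
    fix l assume l: "l \<in> L"
    then obtain s where s: "isGlb UNIV (T l) s" using glbT by blast
    have "a l \<le> s"
      using isGlb_le_isLb[OF s] T_ge[OF l] by (simp add: isLb_def setge_def)
    then show "a l \<le> t" using t[OF l s] by (rule order_trans)
  qed
  ultimately have "isLub UNIV {s. \<exists>l\<in>L. isGlb UNIV (T l) s} x"
    unfolding isLub_def leastP_def setle_def setge_def isUb_def by blast
  moreover have "bdd_above (u ` L)"
    using T_le[OF first(1)] first(2) by (auto simp: T_def intro!: bdd_aboveI)
  moreover have "bdd_below (u ` L)"
    using T_ge[OF first(1)] first(2) by (auto simp: T_def intro!: bdd_belowI)
  ultimately show "order_converges L le u x"
    using dir G unfolding order_converges_def T_def by blast
qed

section \<open>Separation\<close>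

lemma pairing_add: "pairing (v + w) x = pairing v x + pairing w x"
  by (simp add: pairing_def distrib_right sum.distrib)

lemma pairing_zero: "pairing 0 x = 0"
  by (simp add: pairing_def)

lemma pairing_axis: "pairing (axis i c) x = c * x $ i"
proof -
  have "axis i c $ j * x $ j = (if j = i then c * x $ i else 0)" for j
    by (simp add: axis_def)
  then show ?thesis by (simp add: pairing_def)
qed

lemma pairing_ge: "w $ i * x $ i \<le> pairing w x" for w x :: "'a::idempotent_semiring ^ 'n"
  unfolding pairing_def by (rule sum_ge_member) auto

lemma pairing_least:
  fixes w x :: "'a::idempotent_semiring ^ 'n"
  shows "(\<And>i. w $ i * x $ i \<le> c) \<Longrightarrow> pairing w x \<le> c"
  unfolding pairing_def by (rule sum_least) auto

section \<open>Affine inequalities and separability\<close>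

definition separable :: "('a::semiring_0 ^ 'n) set \<Rightarrow> 'a ^ 'n \<Rightarrow> bool"
  where "separable C y \<longleftrightarrow> (\<exists>w' w'' d' d''.
    C \<subseteq> affine_hyperplane w' d' w'' d'' \<and> y \<notin> affine_hyperplane w' d' w'' d'')"

text \<open>Since \<open>p \<le> q\<close> means \<open>p + q = q\<close>, an affine inequality is
  itself an affine equation, obtained by adding the larger side to the smaller one.\<close>

lemma separable_if_le:
  fixes C :: "('a::idempotent_semiring ^ 'n) set"
  assumes "\<And>x. x \<in> C \<Longrightarrow> pairing v x + e \<le> pairing w x + d"
    and "\<not> pairing v y + e \<le> pairing w y + d"
  shows "separable C y"
proof -
  have "pairing (v + w) x + (e + d) = pairing w x + d \<longleftrightarrow> pairing v x + e \<le> pairing w x + d" for x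
    by (simp add: le_iff_add_eq pairing_add ac_simps)
  then have "C \<subseteq> affine_hyperplane (v + w) (e + d) w d"
    "y \<notin> affine_hyperplane (v + w) (e + d) w d"
    using assms by (auto simp: affine_hyperplane_def)
  then show ?thesis unfolding separable_def by blast
qed

lemma separable_if_coordinate_le:
  fixes C :: "('a::idempotent_semiring ^ 'n) set"
  assumes "\<And>x. x \<in> C \<Longrightarrow> c * x $ i \<le> pairing w x + d" and "\<not> c * y $ i \<le> pairing w y + d"
  shows "separable C y"
  using separable_if_le[of C "axis i c" 0 w d y] assms by (simp add: pairing_axis)

lemma separable_if_const_le:
  fixes C :: "('a::idempotent_semiring ^ 'n) set"
  assumes "\<And>x. x \<in> C \<Longrightarrow> e \<le> pairing w x + d" and "\<not> e \<le> pairing w y + d"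
  shows "separable C y"
  using separable_if_le[of C 0 e w d y] assms by (simp add: pairing_zero)

section \<open>Finite convex combinations and their order limits\<close>

text \<open>Weights divided by their total add up to 1; being nonzero, they keep every partial total
  invertible. In the induction the normalised combination over \<open>F\<close> re-enters with
  weight \<open>N * R\<close>, whose factor \<open>N\<close> cancels
  \<open>sf_inverse N\<close>.\<close>

lemma convex_combination:
  fixes C :: "('a::idempotent_semifield ^ 'n) set"
  assumes conv: "semimodule_convex C"
    and F: "finite F" "F \<noteq> {}" "F \<subseteq> C" "\<And>x. x \<in> F \<Longrightarrow> c x \<noteq> 0"
  shows "(\<Sum>x\<in>F. x \<cdot>\<^sub>R c x) \<cdot>\<^sub>R sf_inverse (\<Sum>x\<in>F. c x) \<in> C"
  using F
proof (induction F rule: finite_ne_induct)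
  case (singleton x)
  then show ?case by (simp add: right_scale_def sf_right_inverse mult.assoc)
next
  case (insert x F)
  define Q where "Q = (\<Sum>x\<in>F. x \<cdot>\<^sub>R c x)"
  define N where "N = (\<Sum>x\<in>F. c x)"
  define R where "R = sf_inverse (c x + N)"
  obtain x' where x': "x' \<in> F" using insert.hyps by blast
  have N: "N \<noteq> 0"
    using le_nonzero[OF sum_ge_member[of F x' c]] insert x' by (auto simp: N_def)
  have N': "c x + N \<noteq> 0" using le_nonzero[OF add_ge1] insert.prems by blast
  have "Q \<cdot>\<^sub>R sf_inverse N \<in> C" using insert by (simp add: Q_def N_def)
  moreover have "c x * R + N * R = 1"
    using N' by (simp add: R_def sf_right_inverse flip: distrib_right)
  ultimately have "x \<cdot>\<^sub>R (c x * R) + Q \<cdot>\<^sub>R sf_inverse N \<cdot>\<^sub>R (N * R) \<in> C"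
    using conv insert.prems unfolding semimodule_convex_def by simp
  also have "Q \<cdot>\<^sub>R sf_inverse N \<cdot>\<^sub>R (N * R) = Q \<cdot>\<^sub>R R"
  proof -
    have "q * sf_inverse N * (N * R) = q * (sf_inverse N * N) * R" for q
      by (simp only: mult.assoc)
    then show ?thesis using N by (simp add: right_scale_def sf_left_inverse)
  qed
  also have "x \<cdot>\<^sub>R (c x * R) + Q \<cdot>\<^sub>R R = (x \<cdot>\<^sub>R c x + Q) \<cdot>\<^sub>R R"
    by (simp add: right_scale_def vec_eq_iff mult.assoc distrib_right)
  finally show ?case using insert.hyps by (simp add: Q_def N_def R_def)
qed

text \<open>Normalised combinations over finite sets \<open>F\<close>, ordered by inclusion, are
  squeezed between \<open>Q F\<close>, which increases to \<open>q\<close>, and \<open>q\<close>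
  divided by \<open>N F\<close>, which decreases to \<open>q\<close> because the total weights
  increase to 1.\<close>

lemma convex_sup_mem:
  fixes C :: "('a::cond_complete_idempotent_semifield ^ 'n) set"
  assumes conv: "semimodule_convex C" and closed: "order_closed C" and ne: "C \<noteq> {}"
    and c: "\<And>x. x \<in> C \<Longrightarrow> c x \<noteq> 0" "\<And>x. x \<in> C \<Longrightarrow> c x \<le> 1" "Sup (c ` C) = 1"
    and q: "\<And>x i. x \<in> C \<Longrightarrow> x $ i * c x \<le> q $ i"
      "\<And>i t. (\<And>x. x \<in> C \<Longrightarrow> x $ i * c x \<le> t) \<Longrightarrow> q $ i \<le> t"
  shows "q \<in> C"
proof -
  obtain x0 where x0: "x0 \<in> C" using ne by blast
  \<comment> \<open>A fixed member \<open>x0\<close> makes \<open>{x0}\<close> the least index and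
    every total weight nonzero.\<close>
  define L where "L = {F. finite F \<and> F \<subseteq> C \<and> x0 \<in> F}"
  define Q where "Q F = (\<Sum>x\<in>F. x \<cdot>\<^sub>R c x)" for F
  define N where "N F = (\<Sum>x\<in>F. c x)" for F
  have Q_nth: "Q F $ i = (\<Sum>x\<in>F. x $ i * c x)" for F i
    by (simp add: Q_def right_scale_def)
  have L0: "finite F" "F \<subseteq> C" "x0 \<in> F" if "F \<in> L" for F using that by (auto simp: L_def)
  have N_ge: "c x \<le> N F" if "F \<in> L" "x \<in> F" for F x
    unfolding N_def using L0[OF that(1)] that(2) by (intro sum_ge_member)
  have N0: "N F \<noteq> 0" if "F \<in> L" for F
    using le_nonzero[OF N_ge] c(1) x0 L0(3) that by blast
  have N1: "N F \<le> 1" if "F \<in> L" for F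
    unfolding N_def using L0(2)[OF that] c(2) by (intro sum_least) auto
  have N_mono: "N F \<le> N G" if "F \<in> L" "G \<in> L" "F \<subseteq> G" for F G
    unfolding N_def[of F] using N_ge that by (intro sum_least) auto
  have Q_mono: "Q F \<le> Q G" if "F \<in> L" "G \<in> L" "F \<subseteq> G" for F G
    using L0[OF that(2)] that(3)
    by (auto simp: less_eq_vec_def Q_nth intro!: sum_least sum_ge_member)
  have Qq: "Q F \<le> q" if "F \<in> L" for F
    using L0(2)[OF that] q(1) by (auto simp: less_eq_vec_def Q_nth intro!: sum_least)
  have le_div: "v $ i \<le> v $ i * sf_inverse (N F)" if "F \<in> L" for v :: "'a ^ 'n" and i F
    using mult_left_le[OF N1[OF that], of "v $ i"] N0[OF that]
    by (simp add: le_mult_inverse_right_iff)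
  show ?thesis
  proof (rule order_closed_squeeze[OF closed, where L = L and le = "(\<subseteq>)" and first = "{x0}"
        and u = "\<lambda>F. Q F \<cdot>\<^sub>R sf_inverse (N F)" and a = Q and b = "\<lambda>F. q \<cdot>\<^sub>R sf_inverse (N F)"])
    show "{x0} \<in> L" using x0 by (simp add: L_def)
    show "{x0} \<subseteq> F" if "F \<in> L" for F using that by (simp add: L_def)
    show "directed_preorder L (\<subseteq>)"
      unfolding directed_preorder_def
    proof (intro conjI ballI)
      show "L \<noteq> {}" using \<open>{x0} \<in> L\<close> by blast
      show "reflp_on L (\<subseteq>)" "transp_on L (\<subseteq>)" by (auto intro!: reflp_onI transp_onI)
      fix F G assume "F \<in> L" "G \<in> L"
      then show "\<exists>H\<in>L. F \<subseteq> H \<and> G \<subseteq> H" by (intro bexI[of _ "F \<union> G"]) (auto simp: L_def)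
    qed
    show "Q F \<cdot>\<^sub>R sf_inverse (N F) \<in> C" if "F \<in> L" for F
      unfolding Q_def N_def using L0[OF that] c(1) by (intro convex_combination[OF conv]) auto
    show "Q F \<le> Q G" if "F \<in> L" "G \<in> L" "F \<subseteq> G" for F G using Q_mono that .
    show "q \<cdot>\<^sub>R sf_inverse (N G) \<le> q \<cdot>\<^sub>R sf_inverse (N F)" if "F \<in> L" "G \<in> L" "F \<subseteq> G" for F G
    proof -
      have "sf_inverse (N G) * N F \<le> 1"
        using mult_left_le[OF N_mono[OF that], of "sf_inverse (N G)"] N0[OF that(2)]
        by (simp add: sf_left_inverse)
      then have "sf_inverse (N G) \<le> 1 * sf_inverse (N F)"
        by (simp only: le_mult_inverse_right_iff[OF N0[OF that(1)]])
      then show ?thesis by (simp add: right_scale_def less_eq_vec_def mult_left_le)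
    qed
    show "Q F \<le> Q F \<cdot>\<^sub>R sf_inverse (N F)" if "F \<in> L" for F
      using le_div[OF that] by (simp add: right_scale_def less_eq_vec_def)
    show "Q F \<cdot>\<^sub>R sf_inverse (N F) \<le> q \<cdot>\<^sub>R sf_inverse (N F)" if "F \<in> L" for F
      using Qq[OF that] by (simp add: right_scale_def less_eq_vec_def mult_right_le)
    show "Q F \<le> q" if "F \<in> L" for F using Qq that .
    show "q \<le> t" if t: "\<And>F. F \<in> L \<Longrightarrow> Q F \<le> t" for t
      unfolding less_eq_vec_def
    proof (intro allI q(2))
      fix i x assume x: "x \<in> C"
      have F: "{x0, x} \<in> L" using x x0 by (simp add: L_def)
      have "x $ i * c x \<le> Q {x0, x} $ i"
        unfolding Q_nth by (rule sum_ge_member) auto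
      also have "\<dots> \<le> t $ i" using t[OF F] by (simp add: less_eq_vec_def)
      finally show "x $ i * c x \<le> t $ i" .
    qed
    show "q \<le> q \<cdot>\<^sub>R sf_inverse (N F)" if "F \<in> L" for F
      using le_div[OF that] by (simp add: right_scale_def less_eq_vec_def)
    show "t \<le> q" if t: "\<And>F. F \<in> L \<Longrightarrow> t \<le> q \<cdot>\<^sub>R sf_inverse (N F)" for t
      unfolding less_eq_vec_def
    proof
      fix i
      \<comment> \<open>The bound at the index \<open>{x0, x}\<close> gives this once the total
        weight is cleared. Left multiplication by \<open>t $ i\<close> preserves the supremum over
        \<open>x\<close>, and the weights have supremum 1.\<close>
      have "t $ i * c x \<le> q $ i" if x: "x \<in> C" for x
      proof -
        have F: "{x0, x} \<in> L" using x x0 by (simp add: L_def)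
        have "t $ i * c x \<le> t $ i * N {x0, x}" using N_ge[OF F] by (simp add: mult_left_le)
        also have "\<dots> \<le> q $ i"
          using t[OF F] N0[OF F] by (simp add: right_scale_def less_eq_vec_def le_mult_inverse_right_iff)
        finally show ?thesis .
      qed
      then have "Sup ((\<lambda>a. t $ i * a) ` c ` C) \<le> q $ i"
        using ne by (intro cSup_least) auto
      moreover have "bdd_above (c ` C)" using c(2) by (auto intro!: bdd_aboveI)
      ultimately show "t $ i \<le> q $ i"
        using mult_cSup_left[of "c ` C" "t $ i"] ne c(3) by simp
    qed
  qed
qed

section \<open>Points of \<open>C\<close> between \<open>y\<close> and a bound, and the limit as the
  bound decreases\<close>

lemma separable_or_between:
  fixes C :: "('a::cond_complete_idempotent_semifield ^ 'n) set"
  assumes conv: "semimodule_convex C" and closed: "order_closed C" and ne: "C \<noteq> {}"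
    and z: "\<And>i. z $ i \<noteq> 0" and yz: "y \<le> z" and nsep: "\<not> separable C y"
  shows "\<exists>q\<in>C. y \<le> q \<and> q \<le> z"
proof -
  \<comment> \<open>\<open>pairing w x\<close> is the least factor \<lambda> with x \<le>
    z\<lambda>. Adding 1 makes the divisor \<open>\<mu> x\<close> nonzero and keeps
    \<open>c x\<close> below 1.\<close>
  define w where "w = (\<chi> i. sf_inverse (z $ i))"
  define \<mu> where "\<mu> x = pairing w x + 1" for x
  define c where "c x = sf_inverse (\<mu> x)" for x
  define q where "q = (\<chi> i. Sup ((\<lambda>x. x $ i * c x) ` C))"
  define \<nu> where "\<nu> = Sup (c ` C)"
  have \<mu>1: "1 \<le> \<mu> x" for x by (simp add: \<mu>_def add_ge2)
  have \<mu>0: "\<mu> x \<noteq> 0" for x using \<mu>1 by (rule ge_one_nonzero)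
  have c0: "c x \<noteq> 0" for x using sf_inverse_nonzero[OF \<mu>0] by (simp add: c_def)
  have c1: "c x \<le> 1" for x
    using mult_inverse_right_le_iff[OF \<mu>0, of 1 x 1] \<mu>1 by (simp add: c_def)
  have cz: "x $ i * c x \<le> z $ i" for x i
  proof -
    have "sf_inverse (z $ i) * x $ i \<le> \<mu> x"
      using order_trans[OF pairing_ge[of w i x] add_ge1[of _ 1]] by (simp add: w_def \<mu>_def)
    then show ?thesis
      using z \<mu>0 by (simp add: c_def mult_inverse_left_le_iff mult_inverse_right_le_iff)
  qed
  have bdd: "bdd_above ((\<lambda>x. x $ i * c x) ` C)" for i
    using cz by (auto intro!: bdd_aboveI)
  have bddc: "bdd_above (c ` C)" using c1 by (auto intro!: bdd_aboveI)
  have q_ge: "x $ i * c x \<le> q $ i" if "x \<in> C" for x i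
    using cSUP_upper[OF that bdd] by (simp add: q_def)
  have q_least: "q $ i \<le> t" if "\<And>x. x \<in> C \<Longrightarrow> x $ i * c x \<le> t" for i t
    using cSUP_least[OF ne that] by (simp add: q_def)
  \<comment> \<open>Clearing the divisor turns the bound by \<open>q\<close> into an inequality
    affine in \<open>x\<close>, which can be tested at \<open>y\<close>.\<close>
  have on_C: "x $ i \<le> q $ i * \<mu> x" if "x \<in> C" for x i
    using q_ge[OF that] \<mu>0 by (simp add: c_def mult_inverse_right_le_iff)
  have \<mu>y: "\<mu> y = 1"
  proof (rule antisym[OF _ \<mu>1])
    have "w $ i * y $ i \<le> 1" for i
      using yz z by (simp add: w_def mult_inverse_left_le_iff less_eq_vec_def)
    then show "\<mu> y \<le> 1" unfolding \<mu>_def by (intro add_least pairing_least) auto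
  qed
  have "y $ i \<le> q $ i" for i
  proof (rule ccontr)
    assume n: "\<not> y $ i \<le> q $ i"
    have "separable C y"
    \<comment> \<open>A nonzero \<open>q $ i\<close> is moved to the other side as a left inverse.
      If it is zero, the coordinate vanishes on all of \<open>C\<close> but not at
      \<open>y\<close>.\<close>
    proof (cases "q $ i = 0")
      case True
      then show ?thesis
        using on_C[of _ i] n
        by (intro separable_if_coordinate_le[where w = 0 and d = 0 and i = i and c = 1])
          (auto simp: pairing_zero)
    next
      case False
      then show ?thesis
        using on_C[of _ i] n \<mu>y
        by (intro separable_if_coordinate_le[where w = w and d = 1 and i = i
              and c = "sf_inverse (q $ i)"]) (auto simp: mult_inverse_left_le_iff \<mu>_def)
    qed
    then show False using nsep by blast
  qed
  moreover have "\<nu> = 1"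
  proof (rule antisym)
    show "\<nu> \<le> 1" unfolding \<nu>_def using c1 ne by (intro cSup_least) auto
    have c\<nu>: "c x \<le> \<nu>" if "x \<in> C" for x
      unfolding \<nu>_def using bddc that by (intro cSup_upper) auto
    have \<nu>0: "\<nu> \<noteq> 0" using le_nonzero[OF c\<nu> c0] ne by blast
    \<comment> \<open>This affine form of \<open>c x \<le> \<nu>\<close> passes to \<open>y\<close>
      because no hyperplane separates, and \<open>\<mu> y = 1\<close> then gives
      \<open>1 \<le> \<nu>\<close>.\<close>
    have "sf_inverse \<nu> * 1 \<le> \<mu> x" if "x \<in> C" for x
      using c\<nu>[OF that] mult_inverse_right_le_iff[OF \<mu>0, of 1 x \<nu>]
      by (simp only: mult_inverse_left_le_iff[OF \<nu>0] c_def mult_1_left)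
    then have "sf_inverse \<nu> * 1 \<le> \<mu> y"
      using separable_if_const_le[of C "sf_inverse \<nu> * 1" w 1 y] nsep unfolding \<mu>_def by blast
    then show "1 \<le> \<nu>"
      unfolding \<mu>y mult_inverse_left_le_iff[OF \<nu>0] by simp
  qed
  then have "q \<in> C"
    using convex_sup_mem[OF conv closed ne, of c q] c0 c1 q_ge q_least by (simp add: \<nu>_def)
  moreover have "q \<le> z" using q_least cz by (simp add: less_eq_vec_def)
  ultimately show ?thesis by (auto simp: less_eq_vec_def)
qed

lemma separable_nonBoolean:
  fixes C :: "('a::cond_complete_idempotent_semifield ^ 'n) set"
  assumes conv: "semimodule_convex C" and closed: "order_closed C" and ne: "C \<noteq> {}"
    and y: "y \<notin> C" and e: "e \<noteq> (0::'a)" "\<not> 1 \<le> e"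
  shows "separable C y"
proof (rule ccontr)
  assume nsep: "\<not> separable C y"
  \<comment> \<open>The cap at 1 gives the net, indexed in reverse order, a first index.\<close>
  define L where "L = {c::'a. c \<noteq> 0 \<and> c \<le> 1}"
  \<comment> \<open>Adding \<open>c\<close> to all entries of \<open>y\<close> makes them nonzero,
    as the bound in \<open>separable_or_between\<close> must be.\<close>
  define b where "b c = y + (\<chi> i. c)" for c
  have b_nth: "b c $ i = y $ i + c" for c i by (simp add: b_def)
  have "\<exists>q\<in>C. y \<le> q \<and> q \<le> b c" if "c \<in> L" for c
    using that
    by (intro separable_or_between[OF conv closed ne _ _ nsep])
      (auto simp: L_def b_nth less_eq_vec_def add_ge1 dest: le_nonzero[OF add_ge2])
  then obtain u where u: "\<And>c. c \<in> L \<Longrightarrow> u c \<in> C \<and> y \<le> u c \<and> u c \<le> b c" by metis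
  have "y \<in> C"
  proof (rule order_closed_squeeze[OF closed, where L = L and le = "\<lambda>c d. d \<le> c" and first = 1
        and u = u and a = "\<lambda>_. y" and b = b])
    show "1 \<in> L" by (simp add: L_def)
    show "directed_preorder L (\<lambda>c d. d \<le> c)"
      unfolding directed_preorder_def
    proof (intro conjI ballI)
      show "L \<noteq> {}" using \<open>1 \<in> L\<close> by blast
      show "reflp_on L (\<lambda>c d. d \<le> c)" "transp_on L (\<lambda>c d. d \<le> c)"
        by (auto intro!: reflp_onI transp_onI)
      fix c d assume "c \<in> L" "d \<in> L"
      then show "\<exists>k\<in>L. k \<le> c \<and> k \<le> d"
        by (intro bexI[of _ "inf c d"]) (auto simp: L_def inf_nonzero intro: le_infI1)
    qed
    show "b d \<le> b c" if "d \<le> c" for c d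
      using that by (auto simp: b_nth less_eq_vec_def intro!: add_least add_ge1
          intro: order_trans[OF _ add_ge2])
    show "y \<le> t" if "\<And>c. c \<in> L \<Longrightarrow> y \<le> t" for t using that \<open>1 \<in> L\<close> by blast
    show "y \<le> b c" for c by (simp add: b_nth less_eq_vec_def add_ge1)
    show "t \<le> y" if t: "\<And>c. c \<in> L \<Longrightarrow> t \<le> b c" for t
      unfolding less_eq_vec_def
    proof
      fix i
      have ti: "t $ i \<le> y $ i + d" if "d \<noteq> 0" for d
      proof -
        have "inf d 1 \<in> L" using that by (simp add: L_def inf_nonzero)
        then have "t $ i \<le> y $ i + inf d 1" using t by (simp add: b_nth less_eq_vec_def)
        also have "\<dots> \<le> y $ i + d"
          by (intro add_least add_ge1 order_trans[OF inf_le1 add_ge2])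
        finally show ?thesis .
      qed
      show "t $ i \<le> y $ i"
      \<comment> \<open>At a zero entry of \<open>y\<close>, \<open>t $ i\<close> is below every
        nonzero element and \<open>e\<close> forces it to vanish. At a nonzero entry,
        \<open>y $ i\<close> itself serves as \<open>d\<close> and is absorbed by
        idempotence.\<close>
      proof (cases "y $ i = 0")
        case True
        then have "t $ i = 0" using ti by (intro le_all_nonzero_imp_zero[OF e]) auto
        then show ?thesis by (simp add: zero_least)
      next
        case False
        then show ?thesis using ti[of "y $ i"] by (simp add: add_idem)
      qed
    qed
  qed (use u in \<open>auto simp: L_def\<close>)
  then show False using y by blast
qed

section \<open>The Boolean semifield\<close>

text \<open>No topology is involved: without separation, \<open>y\<close> is a finite sum of points
  of \<open>C\<close> below it, one of them reaching \<open>y\<close> at each coordinate.\<close>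

lemma separable_Boolean:
  fixes C :: "('a::idempotent_semifield ^ 'n) set"
  assumes conv: "semimodule_convex C" and y: "y \<notin> C"
    and Bool: "\<And>e::'a. e = 0 \<or> e = 1"
  shows "separable C y"
proof (rule ccontr)
  assume nsep: "\<not> separable C y"
  \<comment> \<open>The indicator of the zeros of \<open>y\<close>: with entries 0 and 1 only,
    \<open>pairing w x\<close> vanishes exactly when x \<le> y.\<close>
  define w :: "'a ^ 'n" where "w = (\<chi> j. if y $ j = 0 then 1 else 0)"
  have wy: "pairing w y = 0"
    unfolding pairing_def w_def by (intro sum.neutral) auto
  define D where "D = {x \<in> C. pairing w x = 0}"
  have D_le: "x $ j \<le> y $ j" if "x \<in> D" for x j
    using that Bool[of "x $ j"] Bool[of "y $ j"] pairing_ge[of w j x]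
    by (auto simp: D_def w_def le_zero_eq zero_least split: if_splits)
  \<comment> \<open>An inequality that fails at \<open>y\<close> must fail somewhere on
    \<open>C\<close>; with values 0 and 1 only, that failure puts the point into
    \<open>D\<close>.\<close>
  have D: "x \<in> D" if "x \<in> C" "\<not> e \<le> pairing w x" for x e
    using that Bool[of "pairing w x"] Bool[of e] by (auto simp: D_def zero_least)
  obtain x0 where x0: "x0 \<in> D"
    using separable_if_const_le[of C 1 w 0 y] nsep D by (auto simp: wy le_zero_eq)
  have "\<exists>x\<in>D. y $ i \<le> x $ i" for i
  proof (cases "y $ i = 0")
    case True
    then show ?thesis using x0 by (auto simp: zero_least)
  next
    case False
    then obtain x where "x \<in> C" "\<not> x $ i \<le> pairing w x"
      using separable_if_coordinate_le[of C 1 i w 0 y] nsep by (auto simp: wy le_zero_eq)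
    then show ?thesis
      using D[of x "x $ i"] Bool[of "x $ i"] Bool[of "y $ i"] by (auto simp: zero_least intro: bexI[of _ x])
  qed
  then obtain f where f: "\<And>i. f i \<in> D" "\<And>i. y $ i \<le> f i $ i" by metis
  define F where "F = range f"
  have F: "finite F" "F \<noteq> {}" "F \<subseteq> D" using f by (auto simp: F_def)
  \<comment> \<open>\<open>f undefined\<close> is just some member of \<open>F\<close>, which makes
    the sum nonzero.\<close>
  have "(\<Sum>x\<in>F. 1) = (1::'a)"
    using sum_ge_member[of F "f undefined" "\<lambda>_. 1::'a"] Bool[of "\<Sum>x\<in>F. 1"] F
    by (auto simp: F_def le_zero_eq)
  then have "(\<Sum>x\<in>F. x \<cdot>\<^sub>R 1) \<cdot>\<^sub>R 1 \<in> C"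
    using convex_combination[OF conv F(1,2), of "\<lambda>_. 1"] F(3)
    by (auto simp: D_def sf_inverse_one)
  moreover have "(\<Sum>x\<in>F. x \<cdot>\<^sub>R 1) \<cdot>\<^sub>R 1 = y"
    unfolding vec_eq_iff
  proof
    fix i
    have "(\<Sum>x\<in>F. x $ i) = y $ i"
    proof (rule antisym)
      show "(\<Sum>x\<in>F. x $ i) \<le> y $ i" using F D_le by (intro sum_least) auto
      have "f i $ i \<le> (\<Sum>x\<in>F. x $ i)" using F(1) by (intro sum_ge_member) (auto simp: F_def)
      then show "y $ i \<le> (\<Sum>x\<in>F. x $ i)" using f(2)[of i] by order
    qed
    then show "((\<Sum>x\<in>F. x \<cdot>\<^sub>R 1) \<cdot>\<^sub>R 1) $ i = y $ i" by (simp add: right_scale_def)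
  qed
  ultimately show False using y by simp
qed

theorem theorem3p14:
  fixes C :: "('a::cond_complete_idempotent_semifield ^ 'n) set" and y :: "'a ^ 'n"
  assumes "semimodule_convex C" and "order_closed C" and "y \<notin> C"
  shows "\<exists>w' w'' d' d''. C \<subseteq> affine_hyperplane w' d' w'' d'' \<and> y \<notin> affine_hyperplane w' d' w'' d''"
proof -
  have "separable C y"
  proof (cases "\<exists>e::'a. e \<noteq> 0 \<and> \<not> 1 \<le> e")
    case True
    show ?thesis
    proof (cases "C = {}")
      \<comment> \<open>The false inequality \<open>1 \<le> 0\<close> holds vacuously on the empty
        set and fails at \<open>y\<close>.\<close>
      case True
      then show ?thesis
        by (intro separable_if_const_le[where e = 1 and w = 0 and d = 0])
          (auto simp: pairing_zero le_zero_eq)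
    next
      case False
      then show ?thesis using separable_nonBoolean assms True by blast
    qed
  next
    case False
    \<comment> \<open>Both \<open>e\<close> and its inverse are at least 1, so the semifield is
      Boolean.\<close>
    have "e = 1" if "e \<noteq> 0" for e :: 'a
    proof (rule antisym)
      show "1 \<le> e" using False that by blast
      have "1 \<le> sf_inverse e" using False sf_inverse_nonzero[OF that] by blast
      then show "e \<le> 1" using le_mult_inverse_right_iff[OF that, of 1 1] by simp
    qed
    then show ?thesis using separable_Boolean assms by blast
  qed
  then show ?thesis by (simp add: separable_def)
qed

end
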